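(* Let $\lambda$ be a nonzero real number. For every integer $k\ge 0$, the generating function of the heterogeneous Stirling numbers of the first kind is given by the identity of formal power series in $t$ $$\frac{1}{k!}\big(\log_{-\lambda}(1+t)\big)^{k}=\sum_{n=k}^{\infty}G_{\lambda}(n,k)\frac{t^{n}}{n!}.$$
   Context: For any nonzero $\mu\in\mathbb{R}$: $(x)_{0,\mu}=1$, $(x)_{n,\mu}=x(x-\mu)\cdots(x-(n-1)\mu)$ for $n\ge 1$; $\langle x\rangle_{0,\mu}=1$, $\langle x\rangle_{n,\mu}=x(x+\mu)\cdots(x+(n-1)\mu)$ for $n\ge 1$. The falling factorial is $(x)_0=1$, $(x)_n=x(x-1)\cdots(x-n+1)$ for $n\ge 1$. The degenerate exponential is $e_{\mu}(t)=\sum_{n=0}^{\infty}(1)_{n,\mu}\frac{t^n}{n!}$ (that is, $(1+\mu t)^{1/\mu}$), and $\log_\mu t$ is its compositional inverse, so $\log_{\mu}(1+t)=\sum_{n=1}^{\infty}(1)_{n,1/\mu}\,\mu^{n-1}\frac{t^{n}}{n!}$ (that is, $\frac{(1+t)^\mu-1}{\mu}$). The heterogeneous Stirling numbers of the first kind $G_\lambda(n,k)$, $0\le k\le n$, are defined by the polynomial identity $(x)_{n}=\sum_{k=0}^{n}G_{\lambda}(n,k)\langle x\rangle_{k,\lambda}$ for $n\ge 0$. *)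

theory Defs
  imports "HOL-Computational_Algebra.Computational_Algebra"
begin

text \<open>
  The generalized factorials \<open>(x)\<^sub>n\<^sub>,\<^sub>\<mu>\<close> and \<open>\<langle>x\<rangle>\<^sub>n\<^sub>,\<^sub>\<mu>\<close>, over an arbitrary commutative ring so that
  \<open>x\<close> may be a real number or the indeterminate of a polynomial ring.
  The ordinary falling factorial \<open>(x)\<^sub>n\<close> is the case \<open>\<mu> = 1\<close>.
\<close>

definition gfall :: "'a::comm_ring_1 \<Rightarrow> 'a \<Rightarrow> nat \<Rightarrow> 'a" where
  "gfall \<mu> x n = (\<Prod>i<n. x - of_nat i * \<mu>)"

definition grise :: "'a::comm_ring_1 \<Rightarrow> 'a \<Rightarrow> nat \<Rightarrow> 'a" where
  "grise \<mu> x n = (\<Prod>i<n. x + of_nat i * \<mu>)"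

definition deg_exp :: "real \<Rightarrow> real fps" where
  "deg_exp \<mu> = Abs_fps (\<lambda>n. gfall \<mu> 1 n / fact n)"

text \<open>
  The power series \<open>log\<^sub>\<mu>(1 + t)\<close> in \<open>t\<close>. As \<open>log\<^sub>\<mu>\<close> inverts \<open>e\<^sub>\<mu>\<close>, whose constant term is 1,
  this is the compositional inverse of \<open>e\<^sub>\<mu>(t) - 1\<close>; see \<open>deg_log1p_compose\<close> and
  \<open>deg_log1p_nth\<close> below.
\<close>

definition deg_log1p :: "real \<Rightarrow> real fps" where
  "deg_log1p \<mu> = fps_inv (deg_exp \<mu> - 1)"

text \<open>
  \<open>is_hstirling1_row lam n g\<close> says that \<open>g 0, \<dots>, g n\<close> are the coefficients in the polynomial
  identity defining \<open>G\<^sub>\<lambda>(n, k)\<close>; the indeterminate is \<open>[:0, 1:]\<close>. Values beyond \<open>n\<close>,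
  which the identity does not determine, are set to 0.
  The row exists and is unique by \<open>hstirling1_row_ex1\<close>.
\<close>

definition is_hstirling1_row :: "real \<Rightarrow> nat \<Rightarrow> (nat \<Rightarrow> real) \<Rightarrow> bool" where
  "is_hstirling1_row lam n g \<longleftrightarrow>
     gfall 1 [:0, 1:] n = (\<Sum>k\<le>n. smult (g k) (grise [:lam:] [:0, 1:] k)) \<and>
     (\<forall>k>n. g k = 0)"

definition hstirling1 :: "real \<Rightarrow> nat \<Rightarrow> nat \<Rightarrow> real" where
  "hstirling1 lam n = (THE g. is_hstirling1_row lam n g)"


lemma deg_exp_minus_1_nth_0: "(deg_exp \<mu> - 1) $ 0 = 0"
  by (simp add: deg_exp_def gfall_def)

lemma deg_exp_minus_1_nth_1: "(deg_exp \<mu> - 1) $ 1 = 1"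
  by (simp add: deg_exp_def gfall_def)

lemma deg_log1p_compose:
  "deg_log1p \<mu> oo (deg_exp \<mu> - 1) = fps_X"
  "(deg_exp \<mu> - 1) oo deg_log1p \<mu> = fps_X"
  unfolding deg_log1p_def
  by (rule fps_inv fps_inv_right; simp add: deg_exp_def gfall_def)+

lemma deg_exp_nth_Suc:
  "of_nat (Suc n) * deg_exp \<mu> $ Suc n = (1 - of_nat n * \<mu>) * deg_exp \<mu> $ n"
proof -
  have "of_nat (Suc n) * deg_exp \<mu> $ Suc n
          = of_nat (Suc n) * (gfall \<mu> 1 n * (1 - of_nat n * \<mu>) / (of_nat (Suc n) * fact n))"
    by (simp add: deg_exp_def gfall_def)
  also have "\<dots> = gfall \<mu> 1 n * (1 - of_nat n * \<mu>) / fact n"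
    by (simp del: of_nat_Suc)
  finally show ?thesis by (simp add: deg_exp_def)
qed

lemma deg_exp_ODE: "(1 + fps_const \<mu> * fps_X) * fps_deriv (deg_exp \<mu>) = deg_exp \<mu>"
proof (rule fps_ext)
  fix n
  have "((1 + fps_const \<mu> * fps_X) * fps_deriv (deg_exp \<mu>)) $ n
          = of_nat (Suc n) * deg_exp \<mu> $ Suc n + \<mu> * (of_nat n * deg_exp \<mu> $ n)"
    by (cases n) (simp_all add: distrib_right mult.assoc)
  then show "((1 + fps_const \<mu> * fps_X) * fps_deriv (deg_exp \<mu>)) $ n = deg_exp \<mu> $ n"
    unfolding deg_exp_nth_Suc by (simp add: algebra_simps)
qed

lemma deg_log1p_nth:
  assumes "\<mu> \<noteq> 0"
  shows "deg_log1p \<mu> $ n =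
           (if n = 0 then 0 else gfall (1 / \<mu>) 1 n * \<mu> ^ (n - 1) / fact n)"
proof -
  define L where
    "L = Abs_fps (\<lambda>n. if n = 0 then 0 else gfall (1 / \<mu>) 1 n * \<mu> ^ (n - 1) / fact n)"
  define e where "e = deg_exp \<mu>"
  define F where "F = L oo (e - 1)"
  have e0: "(e - 1) $ 0 = 0"
    unfolding e_def by (rule deg_exp_minus_1_nth_0)
  have L0: "L $ 0 = 0" and L1: "L $ 1 = 1"
    by (simp_all add: L_def gfall_def)
  have L_Suc: "of_nat (Suc n) * L $ Suc n = (\<mu> - of_nat n) * L $ n" if "n > 0" for n
  proof -
    have p: "\<mu> ^ n = \<mu> * \<mu> ^ (n - 1)"
      using that by (cases n) auto
    have "of_nat (Suc n) * L $ Suc n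
            = of_nat (Suc n) * (gfall (1 / \<mu>) 1 n * (1 - of_nat n * (1 / \<mu>)) * \<mu> ^ n
                / (of_nat (Suc n) * fact n))"
      by (simp add: L_def gfall_def)
    also have "\<dots> = gfall (1 / \<mu>) 1 n * ((1 - of_nat n * (1 / \<mu>)) * \<mu> * \<mu> ^ (n - 1)) / fact n"
      unfolding p by (simp del: of_nat_Suc)
    also have "(1 - of_nat n * (1 / \<mu>)) * \<mu> = \<mu> - of_nat n"
      using assms by (simp add: field_simps)
    finally show ?thesis using that by (simp add: L_def)
  qed
  have "(1 + fps_X) * fps_deriv L = 1 + fps_const \<mu> * L"
  proof (rule fps_ext)
    fix n
    show "((1 + fps_X) * fps_deriv L) $ n = (1 + fps_const \<mu> * L) $ n"
    proof (cases "n = 0")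
      case True
      then show ?thesis using L0 L1 by simp
    next
      case False
      then have "((1 + fps_X) * fps_deriv L) $ n
                   = of_nat (Suc n) * L $ Suc n + of_nat n * L $ n"
        by (cases n) (simp_all add: distrib_right)
      also have "\<dots> = \<mu> * L $ n"
        using L_Suc[of n] False by (simp add: algebra_simps)
      finally show ?thesis using False by simp
    qed
  qed
  then have "((1 + fps_X) * fps_deriv L) oo (e - 1) = (1 + fps_const \<mu> * L) oo (e - 1)"
    by simp
  then have 1: "e * (fps_deriv L oo (e - 1)) = 1 + fps_const \<mu> * F"
    using e0 by (simp add: fps_compose_mult_distrib fps_compose_add_distrib F_def)
  have 2: "fps_deriv F = (fps_deriv L oo (e - 1)) * fps_deriv e"
    using fps_compose_deriv[OF e0, of L] by (simp add: F_def)
  have 3: "(1 + fps_const \<mu> * fps_X) * fps_deriv e = e"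
    unfolding e_def by (rule deg_exp_ODE)
  have "(1 + fps_const \<mu> * fps_X) * fps_deriv F
          = (fps_deriv L oo (e - 1)) * ((1 + fps_const \<mu> * fps_X) * fps_deriv e)"
    unfolding 2 by (simp add: mult_ac)
  also have "\<dots> = 1 + fps_const \<mu> * F"
    unfolding 3 using 1 by (simp add: mult_ac)
  finally have 4: "(1 + fps_const \<mu> * fps_X) * fps_deriv F = 1 + fps_const \<mu> * F" .
  have F0: "F $ 0 = 0" by (simp add: F_def L_def)
  have F: "F $ n = fps_X $ n" for n
  proof (induction n)
    case 0
    then show ?case using F0 by simp
  next
    case (Suc n)
    have "((1 + fps_const \<mu> * fps_X) * fps_deriv F) $ n = (1 + fps_const \<mu> * F) $ n"
      using 4 by simp
    then have "of_nat (Suc n) * F $ Suc n = (if n = 0 then 1 else (1 - of_nat n) * \<mu> * F $ n)"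
      by (cases n) (simp_all add: F0 algebra_simps)
    with Suc show ?case by (cases "n = 0"; cases "n = 1") auto
  qed
  then have "F = fps_X" by (intro fps_ext)
  then have "L oo (e - 1) oo deg_log1p \<mu> = fps_X oo deg_log1p \<mu>"
    by (simp add: F_def)
  moreover have l0: "deg_log1p \<mu> $ 0 = 0"
    by (simp add: deg_log1p_def fps_inv_def)
  ultimately have "L oo ((e - 1) oo deg_log1p \<mu>) = deg_log1p \<mu>"
    using e0 by (simp add: fps_compose_assoc)
  then have "L = deg_log1p \<mu>"
    unfolding e_def deg_log1p_compose by simp
  then have "deg_log1p \<mu> $ n = L $ n" by simp
  then show ?thesis by (simp only: L_def fps_nth_Abs_fps)
qed

lemma poly_grise: "poly (grise [:lam:] [:0, 1:] k) x = grise lam x k"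
  by (simp add: grise_def poly_prod mult.commute)

lemma grise_sum_eq_0D:
  fixes c :: "nat \<Rightarrow> real"
  assumes "lam \<noteq> 0" and "(\<Sum>k\<le>n. smult (c k) (grise [:lam:] [:0, 1:] k)) = 0" and "j \<le> n"
  shows "c j = 0"
  using \<open>j \<le> n\<close>
proof (induction j rule: less_induct)
  case (less j)
  let ?x = "- (of_nat j * lam)"
  have *: "grise lam ?x k = 0" if "j < k" for k
    using that by (auto simp: grise_def intro!: bexI[of _ j])
  have "0 = poly (\<Sum>k\<le>n. smult (c k) (grise [:lam:] [:0, 1:] k)) ?x"
    using assms(2) by simp
  also have "\<dots> = (\<Sum>k\<le>n. c k * grise lam ?x k)"
    by (simp add: poly_sum poly_grise)
  also have "\<dots> = (\<Sum>k\<in>{j}. c k * grise lam ?x k)"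
  proof (rule sum.mono_neutral_right)
    show "\<forall>i\<in>{..n} - {j}. c i * grise lam ?x i = 0"
    proof
      fix i assume "i \<in> {..n} - {j}"
      then consider "i < j" | "j < i" by force
      then show "c i * grise lam ?x i = 0"
        by cases (use less * in auto)
    qed
  qed (use less in auto)
  finally have "c j * grise lam ?x j = 0" by simp
  moreover have "grise lam ?x j \<noteq> 0"
    using \<open>lam \<noteq> 0\<close> by (auto simp: grise_def)
  ultimately show ?case by simp
qed

lemma hstirling1_row_exists: "\<exists>g. is_hstirling1_row lam n g"
proof (induction n)
  case 0
  show ?case
    by (rule exI[of _ "\<lambda>k. if k = 0 then 1 else 0"])
       (simp add: is_hstirling1_row_def gfall_def grise_def)
next
  case (Suc n)
  let ?R = "grise [:lam:] [:0, 1:]"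
  obtain g where g: "gfall 1 [:0, 1:] n = (\<Sum>k\<le>n. smult (g k) (?R k))" "\<forall>k>n. g k = 0"
    using Suc unfolding is_hstirling1_row_def by blast
  define h where "h k = (case k of 0 \<Rightarrow> 0 | Suc m \<Rightarrow> g m) - (of_nat k * lam + of_nat n) * g k" for k
  have R: "?R k * ([:0, 1:] - of_nat n) = ?R (Suc k) - smult (of_nat k * lam + of_nat n) (?R k)" for k
    by (simp add: grise_def of_nat_poly algebra_simps smult_diff_right flip: smult_add_left)
  have "gfall 1 [:0, 1:] (Suc n) = gfall 1 [:0, 1:] n * ([:0, 1:] - of_nat n :: real poly)"
    by (simp add: gfall_def)
  also have "\<dots> = (\<Sum>k\<le>n. smult (g k) (?R k * ([:0, 1:] - of_nat n)))"
    unfolding g(1) sum_distrib_right by simp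
  also have "\<dots> = (\<Sum>k\<le>n. smult (g k) (?R (Suc k)))
                   - (\<Sum>k\<le>n. smult ((of_nat k * lam + of_nat n) * g k) (?R k))"
    unfolding R by (simp add: smult_diff_right sum_subtractf mult.commute)
  also have "(\<Sum>k\<le>n. smult ((of_nat k * lam + of_nat n) * g k) (?R k))
               = (\<Sum>k\<le>Suc n. smult ((of_nat k * lam + of_nat n) * g k) (?R k))"
    using g(2) by simp
  also have "(\<Sum>k\<le>n. smult (g k) (?R (Suc k)))
               = (\<Sum>k\<le>Suc n. smult (case k of 0 \<Rightarrow> 0 | Suc m \<Rightarrow> g m) (?R k))"
    by (subst sum.atMost_Suc_shift) simp
  also have "\<dots> - (\<Sum>k\<le>Suc n. smult ((of_nat k * lam + of_nat n) * g k) (?R k))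
               = (\<Sum>k\<le>Suc n. smult (h k) (?R k))"
    unfolding h_def smult_diff_left sum_subtractf ..
  finally have "gfall 1 [:0, 1:] (Suc n) = (\<Sum>k\<le>Suc n. smult (h k) (?R k))" .
  moreover have "\<forall>k>Suc n. h k = 0"
    using g(2) by (auto simp: h_def split: nat.split)
  ultimately show ?case
    unfolding is_hstirling1_row_def by blast
qed

lemma hstirling1_row_ex1:
  assumes "lam \<noteq> 0"
  shows "\<exists>!g. is_hstirling1_row lam n g"
proof (rule ex_ex1I)
  show "\<exists>g. is_hstirling1_row lam n g" by (rule hstirling1_row_exists)
next
  fix g h
  assume gh: "is_hstirling1_row lam n g" "is_hstirling1_row lam n h"
  then have "(\<Sum>k\<le>n. smult (g k - h k) (grise [:lam:] [:0, 1:] k)) = 0"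
    by (simp add: is_hstirling1_row_def smult_diff_left sum_subtractf)
  then have "g k - h k = 0" if "k \<le> n" for k
    using grise_sum_eq_0D[OF assms, of "\<lambda>k. g k - h k"] that by blast
  moreover have "g k = h k" if "k > n" for k
    using gh that by (simp add: is_hstirling1_row_def)
  ultimately show "g = h"
    by (intro ext) (metis eq_iff_diff_eq_0 not_le)
qed

lemma hstirling1_row:
  "lam \<noteq> 0 \<Longrightarrow> is_hstirling1_row lam n (hstirling1 lam n)"
  unfolding hstirling1_def using hstirling1_row_ex1 by (rule theI')

end

theory Submission
  imports Defs
begin

text \<open>
  With \<open>L = log\<^sub>\<mu>(1 + t)\<close> one has \<open>(1 + t) L' = 1 + \<mu> L\<close>. For \<open>\<mu> = -\<lambda>\<close>, the series \<open>L\<^sup>k / k!\<close>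
  therefore satisfy a differential equation whose coefficient form is the triangular
  recurrence \<open>G(n + 1, k) = G(n, k - 1) - (k \<lambda> + n) G(n, k)\<close>. The latter follows from
  \<open>x - n = (x + k \<lambda>) - (k \<lambda> + n)\<close> in the defining polynomial identity.
\<close>

lemma grise_Suc: "grise \<mu> x (Suc k) = grise \<mu> x k * (x + of_nat k * \<mu>)"
  by (simp add: grise_def)

lemma gfall_Suc: "gfall \<mu> x (Suc n) = gfall \<mu> x n * (x - of_nat n * \<mu>)"
  by (simp add: gfall_def)

lemma hstirling1_0:
  assumes "lam \<noteq> 0"
  shows "hstirling1 lam 0 k = (if k = 0 then 1 else 0)"
proof -
  have "is_hstirling1_row lam 0 (\<lambda>k. if k = 0 then 1 else 0)"
    by (simp add: is_hstirling1_row_def gfall_def grise_def)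
  then have "hstirling1 lam 0 = (\<lambda>k. if k = 0 then 1 else 0)"
    using hstirling1_row_ex1[OF assms] hstirling1_row[OF assms] by blast
  then show ?thesis
    by simp
qed

lemma hstirling1_eq_0:
  assumes "lam \<noteq> 0" and "n < k"
  shows "hstirling1 lam n k = 0"
  using hstirling1_row[OF assms(1), of n] assms(2) by (simp add: is_hstirling1_row_def)

text \<open>Multiplying row \<open>n\<close> by \<open>x - n\<close> yields a row \<open>h\<close>
  satisfying the defining identity for \<open>Suc n\<close>; uniqueness of rows then identifies
  it.\<close>

lemma hstirling1_Suc:
  assumes "lam \<noteq> 0"
  shows "hstirling1 lam (Suc n) k =
           (if k = 0 then 0 else hstirling1 lam n (k - 1))
             - (of_nat k * lam + of_nat n) * hstirling1 lam n k"
proof -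
  let ?R = "grise [:lam:] [:0, 1:]"
  define g where "g = hstirling1 lam n"
  define h where
    "h k = (if k = 0 then 0 else g (k - 1)) - (of_nat k * lam + of_nat n) * g k" for k
  have g: "gfall 1 [:0, 1:] n = (\<Sum>k\<le>n. smult (g k) (?R k))" "g (Suc n) = 0"
    using hstirling1_row[OF assms, of n] by (simp_all add: g_def is_hstirling1_row_def)
  have R: "?R k * ([:0, 1:] - of_nat n) =
             ?R (Suc k) - smult (of_nat k * lam + of_nat n) (?R k)" for k
  proof -
    have "[:0, 1:] - of_nat n = ([:0, 1:] + of_nat k * [:lam:]) - [:of_nat k * lam + of_nat n:]"
      by (simp add: of_nat_poly)
    then show ?thesis
      by (simp only: grise_Suc right_diff_distrib) simp
  qed
  have "gfall 1 [:0, 1:] (Suc n) = (\<Sum>k\<le>n. smult (g k) (?R k * ([:0, 1:] - of_nat n)))"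
    by (simp add: gfall_Suc g(1) sum_distrib_right)
  also have "\<dots> = (\<Sum>k\<le>n. smult (g k) (?R (Suc k)))
                   - (\<Sum>k\<le>n. smult ((of_nat k * lam + of_nat n) * g k) (?R k))"
    unfolding R by (simp add: smult_diff_right sum_subtractf mult.commute)
  \<comment> \<open>Index shift; the new term at \<open>k = 0\<close> has coefficient 0.\<close>
  also have "(\<Sum>k\<le>n. smult (g k) (?R (Suc k)))
               = (\<Sum>k\<le>Suc n. smult (if k = 0 then 0 else g (k - 1)) (?R k))"
    by (subst sum.atMost_Suc_shift) simp
  \<comment> \<open>The added top term vanishes because \<open>g (Suc n) = 0\<close>.\<close>
  also have "(\<Sum>k\<le>n. smult ((of_nat k * lam + of_nat n) * g k) (?R k))
               = (\<Sum>k\<le>Suc n. smult ((of_nat k * lam + of_nat n) * g k) (?R k))"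
    using g(2) by simp
  finally have "gfall 1 [:0, 1:] (Suc n) = (\<Sum>k\<le>Suc n. smult (h k) (?R k))"
    unfolding h_def smult_diff_left sum_subtractf .
  moreover have "h k = 0" if "k > Suc n" for k
    using that hstirling1_eq_0[OF assms] by (simp add: h_def g_def)
  ultimately have "is_hstirling1_row lam (Suc n) h"
    by (simp add: is_hstirling1_row_def)
  then have "hstirling1 lam (Suc n) = h"
    using hstirling1_row_ex1[OF assms] hstirling1_row[OF assms] by blast
  then show ?thesis
    by (simp add: h_def g_def)
qed

lemma deg_log1p_nth_0: "deg_log1p \<mu> $ 0 = 0"
  by (simp add: deg_log1p_def fps_inv_def)

text \<open>Transports \<open>deg_exp_ODE\<close> through the compositional inverse: compose it with
  \<open>L\<close>, then eliminate the derivative of \<open>deg_exp \<mu>\<close> by the chain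
  rule.\<close>

lemma deg_log1p_ODE:
  "(1 + fps_X) * fps_deriv (deg_log1p \<mu>) = 1 + fps_const \<mu> * deg_log1p \<mu>"
proof -
  define L where "L = deg_log1p \<mu>"
  have L0: "L $ 0 = 0"
    unfolding L_def by (rule deg_log1p_nth_0)
  have eL: "(deg_exp \<mu> - 1) oo L = fps_X"
    unfolding L_def by (rule deg_log1p_compose)
  have chain: "(fps_deriv (deg_exp \<mu>) oo L) * fps_deriv L = 1"
    using fps_compose_deriv[OF L0, of "deg_exp \<mu> - 1"] eL by simp
  have "((1 + fps_const \<mu> * fps_X) * fps_deriv (deg_exp \<mu>)) oo L = deg_exp \<mu> oo L"
    by (simp add: deg_exp_ODE)
  \<comment> \<open>By \<open>eL\<close>, \<open>deg_exp \<mu> oo L\<close> is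
    \<open>1 + fps_X\<close>.\<close>
  then have "(1 + fps_const \<mu> * L) * (fps_deriv (deg_exp \<mu>) oo L) = 1 + fps_X"
    using eL L0
    by (simp add: fps_compose_mult_distrib fps_compose_add_distrib fps_compose_sub_distrib
        algebra_simps)
  then have "(1 + fps_X) * fps_deriv L
      = (1 + fps_const \<mu> * L) * ((fps_deriv (deg_exp \<mu>) oo L) * fps_deriv L)"
    by (simp add: mult.assoc)
  then show ?thesis
    unfolding chain by (simp add: L_def)
qed

text \<open>Compare coefficients of \<open>t^n\<close> in
  \<open>(1 + t) (L^k)' = k L^(k-1) + k \<mu> L^k\<close>, which is \<open>deg_log1p_ODE\<close>
  multiplied by \<open>k L^(k-1)\<close>. For \<open>k = 0\<close> the factor \<open>k\<close>
  cancels the truncated exponent \<open>k - 1\<close>.\<close>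

lemma deg_log1p_power_nth_Suc:
  "of_nat (Suc n) * (deg_log1p \<mu> ^ k) $ Suc n =
     of_nat k * (deg_log1p \<mu> ^ (k - 1)) $ n + (of_nat k * \<mu> - of_nat n) * (deg_log1p \<mu> ^ k) $ n"
proof -
  define L where "L = deg_log1p \<mu>"
  have "(1 + fps_X) * fps_deriv (L ^ k)
          = fps_const (of_nat k) * L ^ (k - 1) * ((1 + fps_X) * fps_deriv L)"
    by (simp add: fps_deriv_power mult_ac)
  also have "\<dots> = fps_const (of_nat k) * L ^ (k - 1) + fps_const (of_nat k * \<mu>) * L ^ k"
    unfolding L_def deg_log1p_ODE
    by (cases k) (simp_all add: algebra_simps flip: fps_const_mult)
  finally have "((1 + fps_X) * fps_deriv (L ^ k)) $ n
      = (fps_const (of_nat k) * L ^ (k - 1) + fps_const (of_nat k * \<mu>) * L ^ k) $ n"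
    by simp
  moreover have "((1 + fps_X) * fps_deriv (L ^ k)) $ n
      = of_nat (Suc n) * (L ^ k) $ Suc n + of_nat n * (L ^ k) $ n"
    by (cases n) (simp_all add: distrib_right)
  ultimately show ?thesis
    by (simp add: L_def algebra_simps)
qed

text \<open>Up to the factor \<open>k!/n!\<close> both sides obey the same recurrence in
  \<open>n\<close>. Since it involves \<open>k - 1\<close>, the induction keeps \<open>k\<close>
  arbitrary.\<close>

lemma deg_log1p_power_nth:
  assumes "lam \<noteq> 0"
  shows "(deg_log1p (- lam) ^ k) $ n = fact k * hstirling1 lam n k / fact n"
proof (induction n arbitrary: k)
  case 0
  then show ?case
    by (simp add: fps_power_zeroth deg_log1p_nth_0 hstirling1_0[OF assms] power_0_left)
next
  case (Suc n)
  let ?G = "hstirling1 lam"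
  have "of_nat (Suc n) * (deg_log1p (- lam) ^ k) $ Suc n =
          (of_nat k * fact (k - 1) * ?G n (k - 1)
             - (of_nat k * lam + of_nat n) * (fact k * ?G n k)) / fact n"
    unfolding deg_log1p_power_nth_Suc Suc.IH
    by (simp add: diff_divide_distrib add_divide_distrib algebra_simps)
  \<comment> \<open>For \<open>k > 0\<close>, \<open>k * fact (k - 1) = fact k\<close>; for
    \<open>k = 0\<close> that term is absent on both sides.\<close>
  also have "\<dots> = fact k * ?G (Suc n) k / fact n"
    by (cases k) (simp_all add: hstirling1_Suc[OF assms] algebra_simps)
  finally show ?case
    by (simp add: field_simps del: of_nat_Suc)
qed

theorem theorem2p4:
  fixes lam :: real and k :: nat
  assumes "lam \<noteq> 0"
  shows "fps_const (1 / fact k) * deg_log1p (- lam) ^ k =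
           Abs_fps (\<lambda>n. if k \<le> n then hstirling1 lam n k / fact n else 0)"
  \<comment> \<open>Below degree \<open>k\<close> the coefficient formula gives 0, matching the
    cutoff.\<close>
  by (rule fps_ext) (simp add: deg_log1p_power_nth[OF assms] hstirling1_eq_0[OF assms])

end
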